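(* Let $M,m,A,A_1,B,B_1>0$ and $\mu:=\frac{2M+m}{m}$, and assume $\mu>1+\frac{A}{4A_1}$, $\mu>1+\frac{B}{16B_1}$ and $(\mu-1)^{4/15}\left(\frac{4A_1}{A}\right)^{2/3}\neq\left(\frac{16B_1}{B}\right)^{2/5}$. Then, in the isosceles Schwarzschild problem (with any angular momentum $C\in\mathbb R$), homographic motions are confined to the horizontal plane with $m$ resting at $O$: every homographic solution satisfies $z(t)=0$ and $P_z(t)=0$ for all times $t$.
   Context: The isosceles Schwarzschild problem: two equal point masses $M$ move in a horizontal plane, symmetrically with respect to their midpoint $O$, and a third point mass $m$ moves on the vertical axis through $O$. Let $R>0$ be the distance between the equal masses and $z\in\mathbb R$ the signed height of $m$ above $O$. After reduction by rotations, with conserved angular momentum $C$, the motion is the Hamiltonian system on $\{(R,z,P_R,P_z):R>0\}$ with $$H_{\mathrm{red}}=\frac1M\left(P_R^2+\frac{C^2}{R^2}\right)+\frac{2M+m}{4Mm}P_z^2-\frac{A}{R}-\frac{B}{R^3}-\frac{4A_1}{(R^2+4z^2)^{1/2}}-\frac{16B_1}{(R^2+4z^2)^{3/2}},$$ the angle $\phi$ of the line of the equal masses satisfying $\dot\phi=2C/(MR^2)$. A solution is homographic if the geometric configuration of the masses remains similar to the initial one, i.e. in Jacobi coordinates (${\bf r}_1$ from one mass $M$ to the other, ${\bf r}_2$ from their midpoint to $m$) ${\bf r}_1(t)=\varphi(t)\Omega(t){\bf a}_1$, ${\bf r}_2(t)=\varphi(t){\bf a}_2$ with $\varphi(t)\in\mathbb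 R\setminus\{0\}$ a scalar function, $\Omega(t)$ rotations about the vertical axis, ${\bf a}_1$ a fixed horizontal vector and ${\bf a}_2$ a fixed vertical vector, not both zero. *)

theory Defs
  imports "HOL-Analysis.Analysis"
begin

definition H_red ::
  "real \<Rightarrow> real \<Rightarrow> real \<Rightarrow> real \<Rightarrow> real \<Rightarrow> real \<Rightarrow> real \<Rightarrow> real \<Rightarrow> real \<Rightarrow> real \<Rightarrow> real \<Rightarrow> real" where
  "H_red M m A A1 B B1 C R z PR Pz =
     1 / M * (PR\<^sup>2 + C\<^sup>2 / R\<^sup>2) + (2 * M + m) / (4 * M * m) * Pz\<^sup>2
     - A / R - B / R ^ 3
     - 4 * A1 / (R\<^sup>2 + 4 * z\<^sup>2) powr (1 / 2)
     - 16 * B1 / (R\<^sup>2 + 4 * z\<^sup>2) powr (3 / 2)"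

(* Hamilton's equations of H_red on a time interval T, together with the equation
   reconstructing the angle \<theta> of the line through the equal masses. The initial
   angle is arbitrary. H_red is differentiable where R > 0, so each deriv below is
   a genuine partial derivative. *)
definition isosceles_schwarzschild_solution ::
  "real \<Rightarrow> real \<Rightarrow> real \<Rightarrow> real \<Rightarrow> real \<Rightarrow> real \<Rightarrow> real \<Rightarrow> real set
   \<Rightarrow> (real \<Rightarrow> real) \<Rightarrow> (real \<Rightarrow> real) \<Rightarrow> (real \<Rightarrow> real) \<Rightarrow> (real \<Rightarrow> real) \<Rightarrow> (real \<Rightarrow> real) \<Rightarrow> bool" where
  "isosceles_schwarzschild_solution M m A A1 B B1 C T R z PR Pz \<theta> \<longleftrightarrow>
     (\<forall>t\<in>T. R t > 0 \<and>
       (R has_real_derivative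
          deriv (\<lambda>p. H_red M m A A1 B B1 C (R t) (z t) p (Pz t)) (PR t)) (at t) \<and>
       (z has_real_derivative
          deriv (\<lambda>p. H_red M m A A1 B B1 C (R t) (z t) (PR t) p) (Pz t)) (at t) \<and>
       (PR has_real_derivative
          - deriv (\<lambda>x. H_red M m A A1 B B1 C x (z t) (PR t) (Pz t)) (R t)) (at t) \<and>
       (Pz has_real_derivative
          - deriv (\<lambda>x. H_red M m A A1 B B1 C (R t) x (PR t) (Pz t)) (z t)) (at t) \<and>
       (\<theta> has_real_derivative 2 * C / (M * (R t)\<^sup>2)) (at t))"

(* Jacobi vectors; the third coordinate axis is the vertical one. *)
definition jacobi1 :: "real \<Rightarrow> real \<Rightarrow> real ^ 3" where
  "jacobi1 R \<theta> = vector [R * cos \<theta>, R * sin \<theta>, 0]"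

definition jacobi2 :: "real \<Rightarrow> real ^ 3" where
  "jacobi2 z = vector [0, 0, z]"

definition horizontal :: "real ^ 3 \<Rightarrow> bool" where
  "horizontal v \<longleftrightarrow> v $ 3 = 0"

definition vertical :: "real ^ 3 \<Rightarrow> bool" where
  "vertical v \<longleftrightarrow> v $ 1 = 0 \<and> v $ 2 = 0"

definition vertical_rotation :: "real ^ 3 ^ 3 \<Rightarrow> bool" where
  "vertical_rotation Q \<longleftrightarrow> rotation_matrix Q \<and> Q *v axis 3 1 = axis 3 1"

(* No regularity in t is imposed on the scale factor \<phi> or on the rotations \<Omega>. *)
definition homographic :: "real set \<Rightarrow> (real \<Rightarrow> real ^ 3) \<Rightarrow> (real \<Rightarrow> real ^ 3) \<Rightarrow> bool" where
  "homographic T r1 r2 \<longleftrightarrow>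
     (\<exists>(\<phi> :: real \<Rightarrow> real) (\<Omega> :: real \<Rightarrow> real ^ 3 ^ 3) a1 a2.
        horizontal a1 \<and> vertical a2 \<and> \<not> (a1 = 0 \<and> a2 = 0) \<and>
        (\<forall>t\<in>T. \<phi> t \<noteq> 0 \<and> vertical_rotation (\<Omega> t) \<and>
           r1 t = \<phi> t *\<^sub>R (\<Omega> t *v a1) \<and> r2 t = \<phi> t *\<^sub>R a2))"

end

theory Submission
  imports Defs
begin

text \<open>
  Along a homographic motion the ratio of \<open>z\<^sup>2\<close> to \<open>R\<^sup>2\<close> is a constant \<open>c\<close>, because rotations
  preserve norms. If \<open>c = 0\<close> the mass \<open>m\<close> rests at \<open>O\<close>. If \<open>c > 0\<close>, differentiating
  \<open>z\<^sup>2 = c R\<^sup>2\<close> twice shows that the two accelerations are tied by \<open>z z'' = c R R''\<close>; since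
  the distances from \<open>m\<close> to the equal masses are \<open>sqrt L / 2\<close> times \<open>R\<close>, where
  \<open>L = 1 + 4 c\<close>, inserting Hamilton's equations turns this into a quadratic equation for the
  single unknown \<open>R\<close>,
    \<open>(A - 4 (\<mu> - 1) A1 L powr (-3/2)) R\<^sup>2 - (2 C\<^sup>2 / M) R + 3 (B - 16 (\<mu> - 1) B1 L powr (-5/2)) = 0\<close>
  with coefficients independent of time (\<open>homographic_quadratic\<close>).

  The leading and the constant coefficient cannot both vanish: each would determine \<open>L\<close>, and the
  two values agree only in the excluded case
  \<open>(\<mu> - 1) powr (4/15) * (4 A1 / A) powr (2/3) = (16 B1 / B) powr (2/5)\<close>
  (\<open>force_balance_incompatible\<close>). So \<open>R\<close> takes at most two values and, being
  continuous on an interval, is constant. Then \<open>z\<^sup>2\<close> is constant too, \<open>z\<close> does not move, and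
  the vertical force vanishes; but that force is attractive and is zero only in the plane
  \<open>z = 0\<close> (\<open>constant_height_imp_planar\<close>).
\<close>

section \<open>Equations of motion\<close>

lemma deriv_H_red_PR:
  assumes "M > 0"
  shows "deriv (\<lambda>p. H_red M m A A1 B B1 C R z p Pz) PR = 2 * PR / M"
  unfolding H_red_def using assms
  by (intro DERIV_imp_deriv) (auto intro!: derivative_eq_intros)

lemma deriv_H_red_Pz:
  assumes "M > 0" "m > 0"
  shows "deriv (\<lambda>p. H_red M m A A1 B B1 C R z PR p) Pz = (2 * M + m) / (2 * M * m) * Pz"
  unfolding H_red_def using assms
  by (intro DERIV_imp_deriv) (auto intro!: derivative_eq_intros simp: field_simps)

lemma has_real_derivative_inverse_powr:
  fixes f :: "real \<Rightarrow> real"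
  assumes "(f has_real_derivative f') (at x)" "f x > 0"
  shows "((\<lambda>x. k / f x powr r) has_real_derivative - r * k * f x powr (- r - 1) * f') (at x)"
proof -
  have "((\<lambda>x. k * f x powr (- r)) has_real_derivative - r * k * f x powr (- r - 1) * f') (at x)"
    using assms by (auto intro!: derivative_eq_intros DERIV_fun_powr)
  then show ?thesis
    by (simp add: powr_minus divide_inverse)
qed

lemma deriv_H_red_z:
  assumes "R > 0"
  shows "deriv (\<lambda>x. H_red M m A A1 B B1 C R x PR Pz) z =
           z * (16 * A1 * (R\<^sup>2 + 4 * z\<^sup>2) powr (- 3 / 2)
                + 192 * B1 * (R\<^sup>2 + 4 * z\<^sup>2) powr (- 5 / 2))"
proof -
  have S: "((\<lambda>x. R\<^sup>2 + 4 * x\<^sup>2) has_real_derivative 8 * z) (at z)"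
    by (auto intro!: derivative_eq_intros)
  have pos: "R\<^sup>2 + 4 * z\<^sup>2 > 0"
    using assms by (simp add: add_pos_nonneg)
  note D = has_real_derivative_inverse_powr[OF S pos]
  show ?thesis
    unfolding H_red_def
    by (rule DERIV_imp_deriv, rule DERIV_cong, rule DERIV_diff, rule DERIV_diff, rule DERIV_const,
        rule D[of "4 * A1" "1/2"], rule D[of "16 * B1" "3/2"]) (simp add: algebra_simps)
qed

lemma deriv_H_red_R:
  assumes "M > 0" "R > 0"
  shows "deriv (\<lambda>x. H_red M m A A1 B B1 C x z PR Pz) R =
           - 2 * C\<^sup>2 / (M * R ^ 3) + A / R\<^sup>2 + 3 * B / R ^ 4
           + R * (4 * A1 * (R\<^sup>2 + 4 * z\<^sup>2) powr (- 3 / 2)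
                  + 48 * B1 * (R\<^sup>2 + 4 * z\<^sup>2) powr (- 5 / 2))"
proof -
  have S: "((\<lambda>x. x\<^sup>2 + 4 * z\<^sup>2) has_real_derivative 2 * R) (at R)"
    by (auto intro!: derivative_eq_intros)
  have pos: "R\<^sup>2 + 4 * z\<^sup>2 > 0"
    using assms by (simp add: add_pos_nonneg)
  note D = has_real_derivative_inverse_powr[OF S pos]
  have K: "((\<lambda>x. 1 / M * (PR\<^sup>2 + C\<^sup>2 / x\<^sup>2)) has_real_derivative - 2 * C\<^sup>2 / (M * R ^ 3)) (at R)"
    using assms
    by (auto intro!: derivative_eq_intros simp: field_simps power2_eq_square power3_eq_cube)
  have A: "((\<lambda>x. A / x) has_real_derivative - (A / R\<^sup>2)) (at R)"
    using assms by (auto intro!: derivative_eq_intros simp: field_simps power2_eq_square)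
  have B: "((\<lambda>x. B / x ^ 3) has_real_derivative - (3 * B / R ^ 4)) (at R)"
    using assms
    by (auto intro!: derivative_eq_intros simp: field_simps eval_nat_numeral)
  show ?thesis
    unfolding H_red_def
    by (rule DERIV_imp_deriv, rule DERIV_cong, rule DERIV_diff, rule DERIV_diff, rule DERIV_diff,
        rule DERIV_diff, rule DERIV_add, rule K, rule DERIV_const, rule A, rule B,
        rule D[of "4 * A1" "1/2"], rule D[of "16 * B1" "3/2"]) (simp add: algebra_simps)
qed

lemma isosceles_schwarzschild_solutionD:
  assumes "M > 0" "m > 0" and sol: "isosceles_schwarzschild_solution M m A A1 B B1 C T R z PR Pz \<theta>"
    and t: "t \<in> T"
  shows "R t > 0"
    and "(R has_real_derivative 2 * PR t / M) (at t)"
    and "(z has_real_derivative (2 * M + m) / (2 * M * m) * Pz t) (at t)"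
    and "(PR has_real_derivative
           2 * C\<^sup>2 / (M * R t ^ 3) - A / (R t)\<^sup>2 - 3 * B / R t ^ 4
           - R t * (4 * A1 * ((R t)\<^sup>2 + 4 * (z t)\<^sup>2) powr (- 3 / 2)
                    + 48 * B1 * ((R t)\<^sup>2 + 4 * (z t)\<^sup>2) powr (- 5 / 2))) (at t)"
    and "(Pz has_real_derivative
           - (z t * (16 * A1 * ((R t)\<^sup>2 + 4 * (z t)\<^sup>2) powr (- 3 / 2)
                     + 192 * B1 * ((R t)\<^sup>2 + 4 * (z t)\<^sup>2) powr (- 5 / 2)))) (at t)"
proof -
  note eqs = sol[unfolded isosceles_schwarzschild_solution_def, rule_format, OF t]
  show pos: "R t > 0"
    using eqs by blast
  show "(R has_real_derivative 2 * PR t / M) (at t)"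
    using eqs by (simp add: deriv_H_red_PR[OF \<open>M > 0\<close>])
  show "(z has_real_derivative (2 * M + m) / (2 * M * m) * Pz t) (at t)"
    using eqs by (simp add: deriv_H_red_Pz[OF \<open>M > 0\<close> \<open>m > 0\<close>])
  have "(PR has_real_derivative
           - deriv (\<lambda>x. H_red M m A A1 B B1 C x (z t) (PR t) (Pz t)) (R t)) (at t)"
    using eqs by blast
  then show "(PR has_real_derivative
           2 * C\<^sup>2 / (M * R t ^ 3) - A / (R t)\<^sup>2 - 3 * B / R t ^ 4
           - R t * (4 * A1 * ((R t)\<^sup>2 + 4 * (z t)\<^sup>2) powr (- 3 / 2)
                    + 48 * B1 * ((R t)\<^sup>2 + 4 * (z t)\<^sup>2) powr (- 5 / 2))) (at t)"
    unfolding deriv_H_red_R[OF \<open>M > 0\<close> pos] by (simp add: algebra_simps)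
  have "(Pz has_real_derivative
           - deriv (\<lambda>x. H_red M m A A1 B B1 C (R t) x (PR t) (Pz t)) (z t)) (at t)"
    using eqs by blast
  then show "(Pz has_real_derivative
           - (z t * (16 * A1 * ((R t)\<^sup>2 + 4 * (z t)\<^sup>2) powr (- 3 / 2)
                     + 192 * B1 * ((R t)\<^sup>2 + 4 * (z t)\<^sup>2) powr (- 5 / 2)))) (at t)"
    unfolding deriv_H_red_z[OF pos] .
qed

section \<open>Motions with constant ratio of height to distance\<close>

lemma norm_vertical_rotation:
  assumes "vertical_rotation Q"
  shows "norm (Q *v a) = norm a"
proof -
  have "orthogonal_matrix Q"
    using assms unfolding vertical_rotation_def rotation_matrix_def by blast
  then have "orthogonal_transformation ((*v) Q)"
    by (simp add: orthogonal_transformation_matrix)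
  then show ?thesis
    by (rule orthogonal_transformation_norm)
qed

lemma norm_jacobi1: "norm (jacobi1 R \<theta>) = \<bar>R\<bar>"
proof -
  have "(norm (jacobi1 R \<theta>))\<^sup>2 = R\<^sup>2 * (cos \<theta>)\<^sup>2 + R\<^sup>2 * (sin \<theta>)\<^sup>2"
    unfolding power2_norm_eq_inner jacobi1_def inner_vec_def sum_3
    by (simp add: power2_eq_square mult_ac)
  also have "\<dots> = R\<^sup>2 * ((sin \<theta>)\<^sup>2 + (cos \<theta>)\<^sup>2)"
    by (simp only: distrib_left add.commute)
  finally have "(norm (jacobi1 R \<theta>))\<^sup>2 = R\<^sup>2 * ((sin \<theta>)\<^sup>2 + (cos \<theta>)\<^sup>2)" .
  then have "(norm (jacobi1 R \<theta>))\<^sup>2 = \<bar>R\<bar>\<^sup>2"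
    by simp
  then show ?thesis
    by (simp only: power2_eq_iff_nonneg norm_ge_zero abs_ge_zero)
qed

lemma norm_jacobi2: "norm (jacobi2 z) = \<bar>z\<bar>"
  unfolding norm_eq_sqrt_inner jacobi2_def inner_vec_def sum_3
  by simp

text \<open>
  Squares are used because the sign of \<open>\<phi>\<close>, hence of \<open>z / R\<close>, is not yet known to be the same
  at all times.
\<close>
lemma homographic_square_ratio:
  assumes "homographic T (\<lambda>t. jacobi1 (R t) (\<theta> t)) (\<lambda>t. jacobi2 (z t))"
    and pos: "\<And>t. t \<in> T \<Longrightarrow> R t > 0"
  obtains c where "c \<ge> 0" "\<And>t. t \<in> T \<Longrightarrow> (z t)\<^sup>2 = c * (R t)\<^sup>2"
proof -
  obtain \<phi> \<Omega> and a1 a2 :: "real ^ 3" where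
    h: "\<And>t. t \<in> T \<Longrightarrow> vertical_rotation (\<Omega> t) \<and>
           jacobi1 (R t) (\<theta> t) = \<phi> t *\<^sub>R (\<Omega> t *v a1) \<and> jacobi2 (z t) = \<phi> t *\<^sub>R a2"
    using assms(1) unfolding homographic_def by blast
  have "(z t)\<^sup>2 = (norm a2 / norm a1)\<^sup>2 * (R t)\<^sup>2" if t: "t \<in> T" for t
  proof -
    have "norm (jacobi1 (R t) (\<theta> t)) = norm (\<phi> t *\<^sub>R (\<Omega> t *v a1))"
      "norm (jacobi2 (z t)) = norm (\<phi> t *\<^sub>R a2)"
      and rot: "vertical_rotation (\<Omega> t)"
      using h[OF t] by simp_all
    then have R: "R t = \<bar>\<phi> t\<bar> * norm a1" and "\<bar>z t\<bar> = \<bar>\<phi> t\<bar> * norm a2"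
      unfolding norm_jacobi1 norm_jacobi2 using pos[OF t] norm_vertical_rotation[OF rot]
      by simp_all
    then have z: "(z t)\<^sup>2 = (\<bar>\<phi> t\<bar> * norm a2)\<^sup>2"
      by (metis power2_abs)
    have "norm a1 \<noteq> 0"
      using R pos[OF t] by auto
    then show ?thesis
      unfolding z R by (simp add: power_mult_distrib power_divide)
  qed
  then show thesis
    by (intro that[of "(norm a2 / norm a1)\<^sup>2"]) auto
qed

lemma derivative_zero_of_constant_on_open:
  fixes f :: "real \<Rightarrow> real"
  assumes "open T" "t \<in> T" "\<And>s. s \<in> T \<Longrightarrow> f s = k" "(f has_real_derivative D) (at t)"
  shows "D = 0"
proof -
  have "(f has_real_derivative 0) (at t)"
    using assms(1-3)
    by (intro has_field_derivative_transform_within_open[OF DERIV_const[of k], of T]) auto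
  then show ?thesis
    using assms(4) DERIV_unique by blast
qed

text \<open>
  The velocity terms drop out of the second derivative of \<open>z\<^sup>2 = c R\<^sup>2\<close>, because the first
  derivative forces \<open>v\<^sup>2 = c u\<^sup>2\<close>.
\<close>
lemma square_ratio_second_derivative:
  fixes R z u v :: "real \<Rightarrow> real"
  assumes "open T" "t \<in> T"
    and ratio: "\<And>s. s \<in> T \<Longrightarrow> (z s)\<^sup>2 = c * (R s)\<^sup>2"
    and R: "\<And>s. s \<in> T \<Longrightarrow> (R has_real_derivative u s) (at s)"
    and z: "\<And>s. s \<in> T \<Longrightarrow> (z has_real_derivative v s) (at s)"
    and u: "(u has_real_derivative u') (at t)"
    and v: "(v has_real_derivative v') (at t)"
    and "z t \<noteq> 0"
  shows "z t * v' = c * R t * u'"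
proof -
  have first: "z s * v s - c * R s * u s = 0" if s: "s \<in> T" for s
  proof -
    have D: "((\<lambda>s. (z s)\<^sup>2 - c * (R s)\<^sup>2) has_real_derivative
             2 * z s * v s - c * (2 * R s * u s)) (at s)"
      by (auto intro!: derivative_eq_intros R[OF s] z[OF s])
    have "2 * z s * v s - c * (2 * R s * u s) = 0"
      by (rule derivative_zero_of_constant_on_open[OF \<open>open T\<close> s _ D, where k = 0])
        (simp add: ratio)
    then show ?thesis
      by simp
  qed
  have D: "((\<lambda>s. z s * v s - c * R s * u s) has_real_derivative
           (v t * v t + z t * v') - c * (u t * u t + R t * u')) (at t)"
    by (auto intro!: derivative_eq_intros R[OF \<open>t \<in> T\<close>] z[OF \<open>t \<in> T\<close>] u v simp: algebra_simps)
  have second: "(v t * v t + z t * v') - c * (u t * u t + R t * u') = 0"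
    by (rule derivative_zero_of_constant_on_open[OF \<open>open T\<close> \<open>t \<in> T\<close> _ D, where k = 0])
      (rule first)
  have "(z t)\<^sup>2 * (v t)\<^sup>2 = (c * R t * u t)\<^sup>2"
    using first[OF \<open>t \<in> T\<close>] by (simp flip: power_mult_distrib)
  also have "\<dots> = (z t)\<^sup>2 * (c * (u t)\<^sup>2)"
    unfolding ratio[OF \<open>t \<in> T\<close>] by (simp add: power2_eq_square)
  finally have "(v t)\<^sup>2 = c * (u t)\<^sup>2"
    using \<open>z t \<noteq> 0\<close> by simp
  then show ?thesis
    using second by (simp add: power2_eq_square algebra_simps)
qed

lemma powr_square_mult:
  fixes R L :: real
  assumes "R > 0" "L > 0"
  shows "(L * R\<^sup>2) powr (- 3 / 2) = L powr (- 3 / 2) / R ^ 3"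
    and "(L * R\<^sup>2) powr (- 5 / 2) = L powr (- 5 / 2) / R ^ 5"
proof -
  have sq: "(R\<^sup>2) powr a = R powr (2 * a)" for a
    using assms by (simp add: powr_powr flip: powr_numeral)
  have neg: "R powr (- 3) = 1 / R ^ 3" "R powr (- 5) = 1 / R ^ 5"
    using assms by (simp_all add: powr_minus divide_inverse)
  show "(L * R\<^sup>2) powr (- 3 / 2) = L powr (- 3 / 2) / R ^ 3"
    "(L * R\<^sup>2) powr (- 5 / 2) = L powr (- 5 / 2) / R ^ 5"
    using assms by (simp_all add: powr_mult sq neg)
qed

text \<open>
  On a motion of constant shape every term of the force on the shape is a power of \<open>R\<close> alone:
  \<open>R\<^sup>-\<^sup>2\<close> from the Newtonian, \<open>R\<^sup>-\<^sup>4\<close> from the relativistic and \<open>R\<^sup>-\<^sup>3\<close> from the centrifugal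
  part. Clearing denominators leaves a quadratic. The factor \<open>2 M / m = \<mu> - 1\<close> is what remains of
  the force of \<open>m\<close> after comparing the vertical acceleration, which carries the reduced
  mass ratio \<open>\<mu>\<close>, with the horizontal one.
\<close>
lemma homographic_quadratic:
  assumes "M > 0" "m > 0" "open T" "t \<in> T" "c > 0"
    and sol: "isosceles_schwarzschild_solution M m A A1 B B1 C T R z PR Pz \<theta>"
    and ratio: "\<And>s. s \<in> T \<Longrightarrow> (z s)\<^sup>2 = c * (R s)\<^sup>2"
  shows "(A - 2 * M / m * (4 * A1) * (1 + 4 * c) powr (- 3 / 2)) * (R t)\<^sup>2
         - 2 * C\<^sup>2 / M * R t
         + 3 * (B - 2 * M / m * (16 * B1) * (1 + 4 * c) powr (- 5 / 2)) = 0"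
proof -
  note eqs = isosceles_schwarzschild_solutionD[OF \<open>M > 0\<close> \<open>m > 0\<close> sol]
  define a where "a = (1 + 4 * c) powr (- 3 / 2)"
  define b where "b = (1 + 4 * c) powr (- 5 / 2)"
  define r where "r = R t"
  have r: "r > 0"
    using eqs(1)[OF \<open>t \<in> T\<close>] by (simp add: r_def)
  have z2: "z t * z t = c * r\<^sup>2"
    using ratio[OF \<open>t \<in> T\<close>] by (simp add: r_def power2_eq_square)
  have z0: "z t \<noteq> 0"
    using z2 r \<open>c > 0\<close> by auto
  have S: "(R t)\<^sup>2 + 4 * (z t)\<^sup>2 = (1 + 4 * c) * r\<^sup>2"
    using ratio[OF \<open>t \<in> T\<close>] by (simp add: r_def algebra_simps)
  have powers: "((R t)\<^sup>2 + 4 * (z t)\<^sup>2) powr (- 3 / 2) = a / r ^ 3"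
    "((R t)\<^sup>2 + 4 * (z t)\<^sup>2) powr (- 5 / 2) = b / r ^ 5"
    unfolding S a_def b_def using powr_square_mult[OF r, of "1 + 4 * c"] \<open>c > 0\<close> by simp_all
  define fR where "fR = 2 * C\<^sup>2 / (M * r ^ 3) - A / r\<^sup>2 - 3 * B / r ^ 4
                        - r * (4 * A1 * (a / r ^ 3) + 48 * B1 * (b / r ^ 5))"
  define g where "g = 16 * A1 * (a / r ^ 3) + 192 * B1 * (b / r ^ 5)"
  have PR: "(PR has_real_derivative fR) (at t)"
    and Pz: "(Pz has_real_derivative - (z t * g)) (at t)"
    using eqs(4,5)[OF \<open>t \<in> T\<close>] unfolding powers fR_def g_def r_def by auto
  note u = DERIV_cdivide[OF DERIV_cmult[OF PR, of 2], of M]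
  note v = DERIV_cmult[OF Pz, of "(2 * M + m) / (2 * M * m)"]
  define \<kappa> where "\<kappa> = (2 * M + m) / (2 * M * m)"
  have "c * r * (2 * fR / M) = z t * (\<kappa> * - (z t * g))"
    using square_ratio_second_derivative[OF \<open>open T\<close> \<open>t \<in> T\<close> ratio eqs(2,3) u v z0]
    unfolding r_def \<kappa>_def by (rule sym)
  also have "\<dots> = - (z t * z t) * \<kappa> * g"
    by simp
  also have "\<dots> = c * r * (- (r * \<kappa> * g))"
    unfolding z2 by (simp add: power2_eq_square)
  finally have "2 * fR / M = - (r * \<kappa> * g)"
    using r \<open>c > 0\<close> by (metis less_irrefl mult_left_cancel no_zero_divisors)
  then have "fR = - (M * \<kappa> / 2) * r * g"
    using \<open>M > 0\<close> by (simp add: field_simps)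
  moreover define n where "n = 2 * M / m"
  moreover have "M * \<kappa> / 2 = (n + 1) / 4"
    using \<open>M > 0\<close> \<open>m > 0\<close> by (simp add: \<kappa>_def n_def field_simps)
  ultimately have "r ^ 3 * fR + (n + 1) / 4 * (r ^ 4 * g) = 0"
    by (simp add: eval_nat_numeral)
  moreover have "r ^ 4 * g = 16 * A1 * a * r + 192 * B1 * b / r"
    unfolding g_def using r by (simp add: field_simps eval_nat_numeral)
  moreover define d where "d = 2 * C\<^sup>2 / M"
  moreover have "r ^ 3 * fR = d - A * r - 3 * B / r - 4 * A1 * a * r - 48 * B1 * b / r"
    unfolding fR_def d_def using r \<open>M > 0\<close> by (simp add: field_simps eval_nat_numeral)
  ultimately have force: "(d - A * r - 3 * B / r - 4 * A1 * a * r - 48 * B1 * b / r)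
      + (n + 1) / 4 * (16 * A1 * a * r + 192 * B1 * b / r) = 0"
    by (simp only:)
  have "(A - n * (4 * A1) * a) * r\<^sup>2 - d * r + 3 * (B - n * (16 * B1) * b)
      = - r * ((d - A * r - 3 * B / r - 4 * A1 * a * r - 48 * B1 * b / r)
               + (n + 1) / 4 * (16 * A1 * a * r + 192 * B1 * b / r))"
    using r by (simp add: field_simps power2_eq_square)
  also have "\<dots> = 0"
    unfolding force by simp
  finally have "(A - n * (4 * A1) * a) * r\<^sup>2 - d * r + 3 * (B - n * (16 * B1) * b) = 0" .
  then show ?thesis
    unfolding a_def b_def r_def n_def d_def .
qed

text \<open>
  Eliminating \<open>L\<close> from \<open>L powr (3/2) = k * p\<close> and \<open>L powr (5/2) = k * q\<close> leaves a relation
  between \<open>k\<close>, \<open>p\<close> and \<open>q\<close>. It is applied with \<open>k = \<mu> - 1\<close>, \<open>p = 4 A1 / A\<close> and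
  \<open>q = 16 B1 / B\<close>, when the Newtonian and the relativistic attractions balance separately.
\<close>
lemma force_balance_incompatible:
  fixes k p q L :: real
  assumes "k > 0" "L > 0" "p > 0" "q > 0"
    and "k * p * L powr (- 3 / 2) = 1"
    and "k * q * L powr (- 5 / 2) = 1"
  shows "k powr (4 / 15) * p powr (2 / 3) = q powr (2 / 5)"
proof -
  have p: "p = L powr (3 / 2) * k powr (- 1)" and q: "q = L powr (5 / 2) * k powr (- 1)"
    using assms by (simp_all add: powr_minus field_simps)
  have "p powr (2 / 3) = L * k powr (- 2 / 3)" "q powr (2 / 5) = L * k powr (- 2 / 5)"
    unfolding p q powr_mult powr_powr using \<open>L > 0\<close> by simp_all
  moreover have "k powr (4 / 15) * k powr (- 2 / 3) = k powr (- 2 / 5)"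
    by (simp flip: powr_add)
  ultimately show ?thesis
    by (simp add: mult.left_commute)
qed

lemma quadratic_constant_on_connected:
  fixes f :: "real \<Rightarrow> real"
  assumes "connected T" "continuous_on T f"
    and "a \<noteq> 0 \<or> e \<noteq> 0"
    and "\<And>t. t \<in> T \<Longrightarrow> a * (f t)\<^sup>2 + b * f t + e = 0"
  shows "f constant_on T"
proof -
  let ?c = "\<lambda>i. [e, b, a] ! i"
  have "?c 0 \<noteq> 0 \<or> ?c 2 \<noteq> 0"
    using assms(3) by auto
  then have "\<exists>i. i \<le> 2 \<and> ?c i \<noteq> 0"
    by (metis order_refl zero_le)
  then have "finite {x. (\<Sum>i\<le>2. ?c i * x ^ i) = 0}"
    unfolding polyfun_finite_roots .
  moreover have "f ` T \<subseteq> {x. (\<Sum>i\<le>2. ?c i * x ^ i) = 0}"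
    using assms(4) by (auto simp: numeral_2_eq_2 algebra_simps)
  ultimately have "finite (f ` T)"
    by (rule rev_finite_subset)
  then show ?thesis
    using assms(1,2) continuous_finite_range_constant by blast
qed

section \<open>Planarity\<close>

lemma square_constant_imp_derivative_zero:
  fixes f :: "real \<Rightarrow> real"
  assumes "open T" "t \<in> T" and sq: "\<And>s. s \<in> T \<Longrightarrow> (f s)\<^sup>2 = k"
    and D: "(f has_real_derivative D) (at t)"
  shows "D = 0"
proof (cases "k = 0")
  case True
  then show ?thesis
    using sq by (intro derivative_zero_of_constant_on_open[OF assms(1,2) _ D, where k = 0]) auto
next
  case False
  have D2: "((\<lambda>s. (f s)\<^sup>2) has_real_derivative 2 * f t * D) (at t)"
    by (auto intro!: derivative_eq_intros D)
  have "2 * f t * D = 0"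
    by (rule derivative_zero_of_constant_on_open[OF assms(1,2) sq D2])
  then show ?thesis
    using sq[OF \<open>t \<in> T\<close>] False by auto
qed

text \<open>
  A mass at rest feels no vertical force, while the vertical force at height \<open>z\<close> is \<open>- z\<close> times
  a positive quantity.
\<close>
lemma constant_height_imp_planar:
  assumes "M > 0" "m > 0" "A1 > 0" "B1 > 0" "open T" "t \<in> T"
    and sol: "isosceles_schwarzschild_solution M m A A1 B B1 C T R z PR Pz \<theta>"
    and sq: "\<And>s. s \<in> T \<Longrightarrow> (z s)\<^sup>2 = k"
  shows "z t = 0 \<and> Pz t = 0"
proof -
  note eqs = isosceles_schwarzschild_solutionD[OF \<open>M > 0\<close> \<open>m > 0\<close> sol]
  have Pz: "Pz s = 0" if s: "s \<in> T" for s
  proof -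
    have "(2 * M + m) / (2 * M * m) * Pz s = 0"
      using square_constant_imp_derivative_zero[OF \<open>open T\<close> s sq eqs(3)[OF s]] .
    then show ?thesis
      using \<open>M > 0\<close> \<open>m > 0\<close> by auto
  qed
  let ?S = "(R t)\<^sup>2 + 4 * (z t)\<^sup>2"
  have "?S > 0"
    using eqs(1)[OF \<open>t \<in> T\<close>] by (simp add: add_pos_nonneg)
  then have "16 * A1 * ?S powr (- 3 / 2) + 192 * B1 * ?S powr (- 5 / 2) > 0"
    using \<open>A1 > 0\<close> \<open>B1 > 0\<close> by (intro add_pos_pos mult_pos_pos) auto
  moreover have "- (z t * (16 * A1 * ?S powr (- 3 / 2) + 192 * B1 * ?S powr (- 5 / 2))) = 0"
    using derivative_zero_of_constant_on_open[OF \<open>open T\<close> \<open>t \<in> T\<close> Pz eqs(5)[OF \<open>t \<in> T\<close>]] .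
  ultimately show ?thesis
    using Pz[OF \<open>t \<in> T\<close>] by (metis less_irrefl mult_eq_0_iff neg_equal_0_iff_equal)
qed

theorem mainTheorem8:
  fixes M m A A1 B B1 C \<mu> :: real
    and T :: "real set"
    and R z PR Pz \<theta> :: "real \<Rightarrow> real"
  assumes "M > 0" "m > 0" "A > 0" "A1 > 0" "B > 0" "B1 > 0"
    and "\<mu> = (2 * M + m) / m"
    and "\<mu> > 1 + A / (4 * A1)"
    and "\<mu> > 1 + B / (16 * B1)"
    and "(\<mu> - 1) powr (4 / 15) * (4 * A1 / A) powr (2 / 3) \<noteq> (16 * B1 / B) powr (2 / 5)"
    and "open T" "is_interval T"
    and "isosceles_schwarzschild_solution M m A A1 B B1 C T R z PR Pz \<theta>"
    and "homographic T (\<lambda>t. jacobi1 (R t) (\<theta> t)) (\<lambda>t. jacobi2 (z t))"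
  shows "\<forall>t\<in>T. z t = 0 \<and> Pz t = 0"
proof (intro ballI)
  note sol = assms(13)
  note planar = constant_height_imp_planar[OF assms(1,2,4,6) \<open>open T\<close> _ sol]
  note eqs = isosceles_schwarzschild_solutionD[OF \<open>M > 0\<close> \<open>m > 0\<close> sol]
  obtain c where "c \<ge> 0" and ratio: "\<And>t. t \<in> T \<Longrightarrow> (z t)\<^sup>2 = c * (R t)\<^sup>2"
    using homographic_square_ratio[OF assms(14) eqs(1)] by blast
  fix t
  assume t: "t \<in> T"
  show "z t = 0 \<and> Pz t = 0"
  proof (cases "c = 0")
    case True
    then show ?thesis
      using planar[OF t, of 0] ratio by simp
  next
    case False
    then have c: "c > 0"
      using \<open>c \<ge> 0\<close> by simp
    have \<mu>: "\<mu> - 1 = 2 * M / m"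
      using assms(2,7) by (simp add: field_simps)
    let ?a = "A - 2 * M / m * (4 * A1) * (1 + 4 * c) powr (- 3 / 2)"
    let ?e = "3 * (B - 2 * M / m * (16 * B1) * (1 + 4 * c) powr (- 5 / 2))"
    have quadratic: "?a * (R s)\<^sup>2 + (- 2 * C\<^sup>2 / M) * R s + ?e = 0" if "s \<in> T" for s
      using homographic_quadratic[OF assms(1,2) \<open>open T\<close> that c sol ratio] by simp
    have "?a \<noteq> 0 \<or> ?e \<noteq> 0"
    proof (rule ccontr)
      assume "\<not> (?a \<noteq> 0 \<or> ?e \<noteq> 0)"
      then have "(\<mu> - 1) * (4 * A1 / A) * (1 + 4 * c) powr (- 3 / 2) = 1"
        "(\<mu> - 1) * (16 * B1 / B) * (1 + 4 * c) powr (- 5 / 2) = 1"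
        unfolding \<mu> using \<open>A > 0\<close> \<open>B > 0\<close> by (auto simp: divide_simps mult_ac)
      then show False
        using force_balance_incompatible[of "\<mu> - 1" "1 + 4 * c" "4 * A1 / A" "16 * B1 / B"]
          assms(1-6,10) c unfolding \<mu> by simp
    qed
    moreover have "connected T"
      using \<open>is_interval T\<close> by (rule is_interval_connected)
    moreover have "continuous_on T R"
      by (intro continuous_at_imp_continuous_on ballI DERIV_isCont[OF eqs(2)])
    ultimately have "R constant_on T"
      by (intro quadratic_constant_on_connected[OF _ _ _ quadratic])
    then obtain k where "\<And>s. s \<in> T \<Longrightarrow> R s = k"
      unfolding constant_on_def by blast
    then show ?thesis
      using planar[OF t, of "c * k\<^sup>2"] ratio by simp
  qed
qed

end
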